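(* Let $\mathbb{K}$ be a field (usually $\mathbb{R}$ or $\mathbb{C}$), and let $T \in (\mathbb{K}^{m})^{\otimes k}$ be a tensor that is not symmetrically concise. Then the stabilizer $\mathrm{Stab}_{\mathbb{K}}(T)$ of $T$ under the congruence action is non-trivial, i.e. it strictly contains $\{\eta I : \eta^k = 1\}$.
   Context: A matrix $X=(x_{ij}) \in \mathrm{GL}(m,\mathbb{K})$ acts on tensors $T=(t_{\alpha_1\ldots\alpha_k}) \in (\mathbb{K}^m)^{\otimes k}$ by congruence, $T \mapsto [\![T;X,X,\ldots,X]\!]$, where $$[\![T;X,\ldots,X]\!]_{\beta_1\ldots\beta_k} = \sum_{\alpha_1,\ldots,\alpha_k=1}^m t_{\alpha_1\ldots\alpha_k}\, x_{\beta_1\alpha_1}\cdots x_{\beta_k\alpha_k}.$$ The stabilizer is $\mathrm{Stab}_{\mathbb{K}}(T) = \{X \in \mathrm{GL}(m,\mathbb{K}) : [\![T;X,\ldots,X]\!] = T\}$. It always contains the matrices $\eta I$ with $\eta \in \mathbb{K}$, $\eta^k=1$. A tensor $T\in(\mathbb{K}^m)^{\otimes k}$ is symmetrically concise if there is no proper linear subspace $W \subsetneq \mathbb{K}^m$ with $T \in W^{\otimes k}$. Equivalently, the $m \times k m^{k-1}$ matrix obtained by concatenating the $k$ principal flattenings $T^{(1)},\ldots,T^{(k)}$ has rank $m$, where $T^{(i)}$ is the $m\times m^{k-1}$ matrix whose rows are labeled by the $i$th index of $T$ and whose columns are labeled by the multi-index of the remaining indices.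
   Formalization: The case m = 1 with K finite and |K| − 1 dividing k is excluded, because there the claim fails: T = 0 is not symmetrically concise, yet its stabilizer K^* equals {η : η^k = 1} (for example K = F_2). *)

theory Defs
  imports "HOL-Analysis.Cartesian_Space"
begin

text \<open>
  The space of order-\<open>k\<close> tensors over \<open>K\<^sup>m\<close> is taken in coordinates: the index types \<open>'k\<close> and \<open>'m\<close>
  stand for \<open>{1..k}\<close> and \<open>{1..m}\<close>, so that a multi-index \<open>(\<alpha>\<^sub>1, \<dots>, \<alpha>\<^sub>k)\<close> is a function \<open>'k \<Rightarrow> 'm\<close>.
  Both types are finite and nonempty, hence \<open>k, m \<ge> 1\<close>.
\<close>

type_synonym ('a, 'm, 'k) tensor = "'a ^ ('k \<Rightarrow> 'm)"

definition pure_tensor :: "('k::finite \<Rightarrow> 'a::field ^ 'm::finite) \<Rightarrow> ('a, 'm, 'k) tensor" where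
  "pure_tensor w = (\<chi> \<alpha>. \<Prod>i\<in>UNIV. w i $ \<alpha> i)"

definition tensor_power :: "('a::field ^ 'm::finite) set \<Rightarrow> ('a, 'm, 'k::finite) tensor set" where
  "tensor_power W = vec.span {pure_tensor w | w. \<forall>i. w i \<in> W}"

definition symmetrically_concise :: "('a::field, 'm::finite, 'k::finite) tensor \<Rightarrow> bool" where
  "symmetrically_concise T \<longleftrightarrow> \<not> (\<exists>W. vec.subspace W \<and> W \<subset> UNIV \<and> T \<in> tensor_power W)"

definition congruence ::
  "('a::field, 'm::finite, 'k::finite) tensor \<Rightarrow> 'a ^ 'm ^ 'm \<Rightarrow> ('a, 'm, 'k) tensor" where
  "congruence T X = (\<chi> \<beta>. \<Sum>\<alpha>\<in>UNIV. T $ \<alpha> * (\<Prod>i\<in>UNIV. X $ \<beta> i $ \<alpha> i))"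

definition Stab :: "('a::field, 'm::finite, 'k::finite) tensor \<Rightarrow> ('a ^ 'm ^ 'm) set" where
  "Stab T = {X. invertible X \<and> congruence T X = T}"

end

theory Submission
  imports Defs "HOL-Computational_Algebra.Polynomial" "HOL-Library.FuncSet"
begin

text \<open>
  If \<open>T \<in> W\<^sup>\<otimes>\<^sup>k\<close> then every invertible matrix fixing \<open>W\<close> pointwise stabilizes \<open>T\<close>. In dimension at
  least two, a proper subspace is fixed pointwise by a nontrivial transvection, which is never
  scalar. In dimension one, \<open>W = 0\<close>, so all nonzero scalars stabilize \<open>T\<close>, and the hypothesis on
  \<open>k\<close> provides one that is not a \<open>k\<close>-th root of unity.
\<close>

lemma mat_vector_mult: "mat c *v v = c *s (v :: 'a::comm_semiring_1 ^ 'n)"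
  by (simp add: vec_eq_iff matrix_vector_mult_def mat_def if_distrib [of "\<lambda>z. z * _"] cong: if_cong)

lemma invertible_mat:
  assumes "(c :: 'a::field) \<noteq> 0"
  shows "invertible (mat c :: 'a ^ 'n ^ 'n)"
proof -
  have "mat a ** mat b = (mat (a * b) :: 'a ^ 'n ^ 'n)" for a b
    by (simp add: matrix_eq mat_vector_mult vector_smult_assoc flip: matrix_vector_mul_assoc)
  then have "mat c ** mat (inverse c) = (mat 1 :: 'a ^ 'n ^ 'n)"
    and "mat (inverse c) ** mat c = (mat 1 :: 'a ^ 'n ^ 'n)"
    using assms by simp_all
  then show ?thesis
    unfolding invertible_def by blast
qed

lemma congruence_pure_tensor: "congruence (pure_tensor w) X = pure_tensor (\<lambda>i. X *v w i)"
proof -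
  have "(\<Prod>i\<in>UNIV. \<Sum>j\<in>UNIV. X $ \<beta> i $ j * w i $ j)
      = (\<Sum>\<alpha>\<in>UNIV. (\<Prod>i\<in>UNIV. w i $ \<alpha> i) * (\<Prod>i\<in>UNIV. X $ \<beta> i $ \<alpha> i))" for \<beta>
    by (subst prod_sum_PiE) (simp_all add: PiE_UNIV_domain prod.distrib mult.commute)
  then show ?thesis
    by (simp add: congruence_def pure_tensor_def matrix_vector_mult_def vec_eq_iff)
qed

lemma linear_congruence: "Vector_Spaces.linear (*s) (*s) (\<lambda>T. congruence T X)"
  by unfold_locales
    (simp_all add: congruence_def vec_eq_iff sum.distrib sum_distrib_left algebra_simps)

text \<open>The action is linear in \<open>T\<close>, so it is enough to compare it with the
  identity on the pure tensors spanning \<open>tensor_power W\<close>, where \<open>X\<close> acts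
  on each factor separately.\<close>

lemma congruence_fixed:
  fixes T :: "('a::field, 'm::finite, 'k::finite) tensor"
  assumes "T \<in> tensor_power W" and "\<And>w. w \<in> W \<Longrightarrow> X *v w = w"
  shows "congruence T X = T"
proof -
  have "Vector_Spaces.linear (*s) (*s) (\<lambda>T :: ('a, 'm, 'k) tensor. T)"
    by unfold_locales simp_all
  then show ?thesis
    by (rule vec.linear_eq_on [OF linear_congruence _ assms(1) [unfolded tensor_power_def]])
      (auto simp: congruence_pure_tensor assms(2))
qed

lemma congruence_mat:
  fixes T :: "('a::field, 'm::finite, 'k::finite) tensor"
  shows "congruence T (mat c) = c ^ CARD('k) *s T"
proof -
  have "(\<Prod>i\<in>UNIV. mat c $ \<beta> i $ \<alpha> i) = (if \<alpha> = \<beta> then c ^ CARD('k) else 0)"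
    for \<alpha> \<beta> :: "'k \<Rightarrow> 'm"
    by (auto simp: mat_def fun_eq_iff)
  then show ?thesis
    by (simp add: congruence_def vec_eq_iff if_distrib [of "\<lambda>z. _ * z"] mult.commute cong: if_cong)
qed

lemma scalar_subset_Stab:
  fixes T :: "('a::field, 'm::finite, 'k::finite) tensor"
  shows "{mat \<eta> | \<eta> :: 'a. \<eta> ^ CARD('k) = 1} \<subseteq> Stab T"
proof -
  have "invertible (mat \<eta> :: 'a ^ 'm ^ 'm)" if "\<eta> ^ CARD('k) = 1" for \<eta> :: 'a
    using that by (intro invertible_mat) (auto simp: power_0_left)
  then show ?thesis
    by (auto simp: Stab_def congruence_mat)
qed

text \<open>Take \<open>X = mat 1 + N\<close>, where \<open>N\<close> sends a basis vector
  \<open>v\<close> outside \<open>W\<close> to another basis vector \<open>u\<close> and kills the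
  rest of a basis extending one of \<open>W\<close>. Then \<open>N\<close> vanishes on
  \<open>W\<close> and squares to zero, so \<open>mat 1 - N\<close> inverts
  \<open>X\<close>.\<close>

lemma exists_nonscalar_fixing_subspace:
  fixes W :: "('a::field ^ 'm::finite) set"
  assumes W: "vec.subspace W" "W \<subset> UNIV" and m: "CARD('m) > 1"
  obtains X :: "'a ^ 'm ^ 'm"
  where "invertible X" "\<And>w. w \<in> W \<Longrightarrow> X *v w = w" "\<And>c. X \<noteq> mat c"
proof -
  obtain B where B: "vec.independent B" "vec.span B = W"
    using vec.basis_exists [of W] vec.span_subspace W(1) by metis
  define C where "C = vec.extend_basis B"
  have C: "B \<subseteq> C" "vec.independent C" "vec.span C = UNIV"
    unfolding C_def using B(1)
    by (simp_all add: vec.extend_basis_superset vec.independent_extend_basis)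
  then obtain v where v: "v \<in> C" "v \<notin> B"
    using B(2) W(2) by (metis psubsetE subsetI vec.span_mono)
  have "card C = CARD('m)"
    using vec.basis_card_eq_dim [of C UNIV] C by (simp add: card_cart_basis)
  \<comment> \<open>Dimension at least two enters here. It does not matter whether \<open>u\<close>
    lies in \<open>W\<close>.\<close>
  then obtain u where u: "u \<in> C" "u \<noteq> v"
    using m card_le_Suc0_iff_eq [of C] v(1) vec.finiteI_independent [OF C(2)]
    by (metis One_nat_def not_le)
  obtain f where f: "Vector_Spaces.linear (*s) (*s) f" "\<forall>x\<in>C. f x = (if x = v then u else 0)"
    using vec.linear_independent_extend [OF C(2), of "\<lambda>x. if x = v then u else 0"] by blast
  define N :: "'a ^ 'm ^ 'm" where "N = matrix f"
  have N: "N *v x = (if x = v then u else 0)" if "x \<in> C" for x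
    using f that by (simp add: N_def matrix_works)
  have NN: "N *v (N *v x) = 0" for x
  proof -
    have "(N ** N) *v x = 0 *v x"
      by (rule vec.linear_eq_on [OF matrix_vector_mul_linear_gen matrix_vector_mul_linear_gen,
            of _ C])
        (use C(3) N u in \<open>auto simp flip: matrix_vector_mul_assoc\<close>)
    then show ?thesis
      by (simp add: matrix_vector_mul_assoc)
  qed
  define X where "X = mat 1 + N"
  have X: "X *v x = x + N *v x" for x
    by (simp add: X_def matrix_vector_mult_add_rdistrib)
  have "X ** (mat 1 - N) = mat 1" "(mat 1 - N) ** X = mat 1"
    by (simp_all add: matrix_eq X NN matrix_vector_mult_add_rdistrib matrix_vector_mult_diff_rdistrib
        vec.add vec.diff flip: matrix_vector_mul_assoc)
  then have "invertible X"
    unfolding invertible_def by blast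
  moreover have "X *v w = w" if "w \<in> W" for w
  proof -
    have "N *v w = 0 *v w"
      by (rule vec.linear_eq_on [OF matrix_vector_mul_linear_gen matrix_vector_mul_linear_gen,
            of _ B]) (use that B(2) N C(1) v(2) in auto)
    then show ?thesis
      by (simp add: X)
  qed
  moreover have "X \<noteq> mat c" for c
  proof
    assume "X = mat c"
    \<comment> \<open>As \<open>u\<close> is nonzero, the first equation forces
      \<open>c = 1\<close>; the second then gives \<open>u = 0\<close>.\<close>
    then have "c *s u = u" "c *s v = v + u"
      using X [of u] X [of v] N u v(1) by (simp_all add: mat_vector_mult)
    moreover have "u \<noteq> 0"
      using C(2) u(1) vec.dependent_zero by blast
    ultimately show False
      by (metis add_cancel_right_right vector_mul_rcancel vector_smult_lid)
  qed
  ultimately show thesis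
    using that by blast
qed

text \<open>Multiplication by \<open>x\<close> permutes the nonzero elements, so it preserves their
  product, which is nonzero and can be cancelled.\<close>

lemma finite_field_power_eq_1:
  fixes x :: "'a::field"
  assumes "finite (UNIV :: 'a set)" "x \<noteq> 0"
  shows "x ^ (CARD('a) - 1) = 1"
proof -
  have "(\<Prod>y\<in>UNIV - {0}. x * y) = (\<Prod>y\<in>UNIV - {0}. y)"
    by (rule prod.reindex_bij_witness [of _ "\<lambda>y. y / x" "\<lambda>y. x * y"]) (use assms(2) in auto)
  then show ?thesis
    using assms(1) by (simp add: prod.distrib card_Diff_singleton)
qed

lemma roots_of_unity:
  assumes "n > 0"
  shows "finite {x :: 'a::field. x ^ n = 1}" "card {x :: 'a. x ^ n = 1} \<le> n"
proof -
  define p :: "'a poly" where "p = monom 1 n - 1"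
  \<comment> \<open>Since \<open>n > 0\<close>, the constant term cannot cancel the leading
    one.\<close>
  have "coeff p n = 1"
    using assms by (simp add: p_def)
  then have "p \<noteq> 0"
    by auto
  moreover have "degree p \<le> n"
    unfolding p_def by (intro degree_diff_le degree_monom_le) simp
  moreover have "{x. poly p x = 0} = {x. x ^ n = 1}"
    by (auto simp: p_def poly_monom)
  ultimately show "finite {x :: 'a. x ^ n = 1}" "card {x :: 'a. x ^ n = 1} \<le> n"
    using poly_roots_finite [of p] card_poly_roots_bound [of p] by simp_all
qed

text \<open>
  The exponents annihilating the multiplicative group are closed under gcd, and no positive exponent
  below \<open>CARD('a) - 1\<close> annihilates it since a polynomial has no more roots than its degree. This
  avoids the cyclicity of the group.
\<close>
lemma all_roots_of_unity_imp_card_dvd: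
  assumes k: "k > 0" and roots: "\<And>x :: 'a::field. x \<noteq> 0 \<Longrightarrow> x ^ k = 1"
  shows "finite (UNIV :: 'a set)" "CARD('a) - 1 dvd k"
proof -
  \<comment> \<open>Zero and the finitely many \<open>k\<close>-th roots of unity exhaust the
    field.\<close>
  have "UNIV = insert 0 {x :: 'a. x ^ k = 1}"
    using roots by auto
  then show fin: "finite (UNIV :: 'a set)"
    using roots_of_unity(1) [OF k, where ?'a = 'a] by (metis finite_insert)
  define q where "q = CARD('a) - 1"
  define d where "d = gcd k q"
  have d: "d > 0"
    using k by (simp add: d_def)
  \<comment> \<open>Bezout in this subtraction-free form keeps all exponents natural.\<close>
  obtain a b where ab: "k * a = q * b + d"
    using bezout_nat [of k q] k by (auto simp: d_def)
  have "x ^ d = 1" if "x \<noteq> 0" for x :: 'a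
  proof -
    have "(x ^ k) ^ a = (x ^ q) ^ b * x ^ d"
      by (simp add: ab flip: power_mult power_add)
    then show ?thesis
      using roots [OF that] finite_field_power_eq_1 [OF fin that] by (simp add: q_def)
  qed
  then have "UNIV - {0} \<subseteq> {x :: 'a. x ^ d = 1}"
    by blast
  then have "card (UNIV - {0 :: 'a}) \<le> d"
    using roots_of_unity [OF d, where ?'a = 'a] card_mono le_trans by blast
  then have "q \<le> d"
    using fin by (simp add: q_def card_Diff_singleton)
  moreover have "q > 0"
    using card_mono [OF fin, of "{0, 1}"] by (simp add: q_def)
  moreover have "d dvd q" "d dvd k"
    by (simp_all add: d_def)
  ultimately show "CARD('a) - 1 dvd k"
    unfolding q_def [symmetric] by (metis dvd_imp_le le_antisym)
qed

text \<open>The first hypothesis excludes a genuine exception: for \<open>m = 1\<close> a tensor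
  that is not concise is 0 and all nonzero scalars stabilize it, but over a finite field with
  \<open>CARD('a) - 1\<close> dividing \<open>k\<close> these are all \<open>k\<close>-th roots of
  unity.\<close>

theorem proposition3p1:
  fixes T :: "('a::field, 'm::finite, 'k::finite) tensor"
  assumes nondegenerate:
      "\<not> (CARD('m) = 1 \<and> finite (UNIV :: 'a set) \<and> (CARD('a) - 1) dvd CARD('k))"
    and not_concise: "\<not> symmetrically_concise T"
  shows "{mat \<eta> | \<eta> :: 'a. \<eta> ^ CARD('k) = 1} \<subset> Stab T"
proof -
  obtain W where W: "vec.subspace W" "W \<subset> UNIV" "T \<in> tensor_power W"
    using not_concise unfolding symmetrically_concise_def by blast
  have "\<exists>X\<in>Stab T. X \<notin> {mat \<eta> | \<eta> :: 'a. \<eta> ^ CARD('k) = 1}"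
  proof (cases "CARD('m) = 1")
    case True
    then obtain \<eta> :: 'a where \<eta>: "\<eta> \<noteq> 0" "\<eta> ^ CARD('k) \<noteq> 1"
      using nondegenerate all_roots_of_unity_imp_card_dvd [of "CARD('k)", where ?'a = 'a]
      by fastforce
    have "vec.dim W < CARD('m)"
      using vec.dim_psubset [of W UNIV] W
      by (simp add: vec.span_eq_iff [THEN iffD2] card_cart_basis)
    then have "W \<subseteq> {0}"
      using True vec.dim_eq_0 by simp
    then have "congruence T (mat \<eta>) = T"
      by (intro congruence_fixed [OF W(3)]) auto
    then have "mat \<eta> \<in> Stab T"
      using \<eta>(1) by (simp add: Stab_def invertible_mat)
    \<comment> \<open>The index type is nonempty, so the diagonal entry at \<open>undefined\<close>
      recovers the scalar.\<close>
    moreover have "\<eta>' = \<eta>" if "mat \<eta>' = (mat \<eta> :: 'a ^ 'm ^ 'm)" for \<eta>'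
      using arg_cong [OF that, of "\<lambda>A. A $ undefined $ undefined"] by (simp add: mat_def)
    then have "mat \<eta> \<notin> {mat \<eta>' :: 'a ^ 'm ^ 'm | \<eta>'. \<eta>' ^ CARD('k) = 1}"
      using \<eta>(2) by auto
    ultimately show ?thesis
      by blast
  next
    case False
    then have "CARD('m) > 1"
      using zero_less_card_finite [where ?'a = 'm] by linarith
    then obtain X :: "'a ^ 'm ^ 'm"
      where "invertible X" "\<And>w. w \<in> W \<Longrightarrow> X *v w = w" "\<And>c. X \<noteq> mat c"
      using exists_nonscalar_fixing_subspace W(1,2) by blast
    then show ?thesis
      using congruence_fixed [OF W(3)] by (auto simp: Stab_def)
  qed
  with scalar_subset_Stab show ?thesis
    by blast
qed

end
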